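(* Let $\mathcal{G}$ be a finite quiver (self-loops allowed, at most one directed edge from any vertex to any other vertex). Every walk $w$ on $\mathcal{G}$ admits a canonical factorization, i.e. an expression of $w$ as iterated nesting products of simple paths and simple cycles of $\mathcal{G}$, and any two canonical factorizations of $w$ are equivalent. In particular the set of irreducible factors of $w$ is uniquely determined by $w$: every walk factorizes uniquely into nesting products of the prime elements of $K\mathcal{G}_\odot$, which are the simple paths and simple cycles of $\mathcal{G}$. Thus $K\mathcal{G}_\odot$ is a noncommutative, nonassociative unique factorization near-algebra with zero-divisors.
   Context: A walk of length $n\ge 1$ on $\mathcal{G}$ is a sequence of contiguous edges $(\mu_0\mu_1)(\mu_1\mu_2)\cdots(\mu_{n-1}\mu_n)$, described by its vertex string $(\mu_0\,\mu_1\cdots\mu_n)$; $h(w)=\mu_0$, $t(w)=\mu_n$. For each vertex $\mu$ there is a trivial walk $(\mu)$ of length $0$. A walk with $\mu_0=\mu_n$ is a cycle (off $\mu_0$), otherwise it is open. $W_{\mathcal{G}}$ denotes the set of all walks. A simple path is an open walk whose vertices are all distinct; a simple cycle is a cycle whose internal vertices are all distinct and different from its initial vertex; a trivial walk counts as both a simple path and a simple cycle. Canonical couple: let $b=(\beta\,\beta_2\cdots\beta_q\,\beta)$ be a cycle off $\beta$ and $a=(\alpha_1\cdots\alpha_k)$ a walk visiting $\beta$, and let $\alpha_j=\beta$ be the last appearance of $\beta$ in $a$. Then $(a,b)$ is canonical iff either (i) $a$ and $b$ are both cycles off $\beta$, or (ii) no vertex $\alpha_i\neq\beta$ with $i<j$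 is visited by $b$. Nesting product: if $(w_1,w_2)$ is canonical with $w_2$ a cycle off $\beta$, then $w_1\odot w_2$ is the walk whose vertex string is obtained from that of $w_1$ by replacing the last appearance of $\beta$ by the entire vertex string of $w_2$; for all other pairs $w\odot w'=0$, where $0$ is an absorbing zero element ($0\odot w=w\odot 0=0$). Quiver near-algebra $K\mathcal{G}_\odot$: for $K$ an algebraically closed field, the near $K$-algebra with basis $W_{\mathcal{G}}$, product the nesting product, and addition of two walks nonzero only if they have the same initial and same final vertex (nesting is right- but not left-distributive). Divisibility: $w'\mid w$ iff there exist walks $a,b$ with $w=(a\odot w')\odot b$ or $w=a\odot(w'\odot b)$. A walk $w$ is prime iff $w\mid a\odot b$ implies $w\mid a$ or $w\mid b$; it is irreducible iff whenever $a\mid w$, $a$ is trivial or $a=w$ up to nesting with trivial walks. A factorization of $w$ is an expression of $w$ as iterated (parenthesized) nesting products of walks; a canonical factorization is one whose factors are all simple paths or simple cycles. Two factorizations of $w$ are equivalent iff one can be obtained from the other by reordering parentheses and factors, and up to nesting with trivial walks, without modifying $w$.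
   Formalization: Divisibility also allows w = w'⊙b (else all open walks are vacuously prime); primality tests nonzero a⊙b only; noncommutativity and nonassociativity need an edge between distinct vertices, zero-divisors two vertices; nonparallel sums vanish only as the nested factor. *)

theory Defs
  imports
    "Graph_Theory.Digraph"
    "Graph_Theory.Vertex_Walk"
    "HOL-Library.Poly_Mapping"
    "HOL-Computational_Algebra.Polynomial"
begin

text \<open>
  A walk is given by its vertex string, as in \<^const>\<open>vwalk\<close>; the string \<open>[v]\<close> is the trivial walk
  at \<open>v\<close>.  The simple paths, trivial ones included, are the walks satisfying \<^const>\<open>vpath\<close>: a walk
  of positive length with distinct vertices is automatically open.
\<close>

definition trivial_walk :: "'v vwalk \<Rightarrow> bool" where
  "trivial_walk w \<longleftrightarrow> vwalk_length w = 0"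

definition cycle_off :: "'v \<Rightarrow> 'v vwalk \<Rightarrow> bool" where
  "cycle_off v w \<longleftrightarrow> w \<noteq> [] \<and> hd w = v \<and> last w = v"

text \<open>The internal vertices of \<open>w\<close> are \<open>tl (butlast w)\<close>; self-loops \<open>[v, v]\<close> have none.\<close>

definition simple_cycle :: "'v vwalk \<Rightarrow> ('v, 'e) pre_digraph \<Rightarrow> bool" where
  "simple_cycle w G \<longleftrightarrow> vwalk w G \<and> cycle_off (hd w) w \<and>
     distinct (tl (butlast w)) \<and> hd w \<notin> set (tl (butlast w))"

definition simple_walk :: "('v, 'e) pre_digraph \<Rightarrow> 'v vwalk \<Rightarrow> bool" where
  "simple_walk G w \<longleftrightarrow> vpath w G \<or> simple_cycle w G"


section \<open>The nesting product\<close>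

definition last_pos :: "'v vwalk \<Rightarrow> 'v \<Rightarrow> nat" where
  "last_pos a v = (GREATEST i. i < length a \<and> a ! i = v)"

definition canonical :: "'v vwalk \<Rightarrow> 'v vwalk \<Rightarrow> bool" where
  "canonical a b \<longleftrightarrow> cycle_off (hd b) b \<and> hd b \<in> set a \<and>
     (cycle_off (hd b) a \<or>
      (\<forall>i < last_pos a (hd b). a ! i \<noteq> hd b \<longrightarrow> a ! i \<notin> set b))"

text \<open>\<open>None\<close> plays the role of the absorbing zero.\<close>

definition nest :: "'v vwalk \<Rightarrow> 'v vwalk \<Rightarrow> 'v vwalk option" where
  "nest a b =
     (if canonical a b
      then Some (take (last_pos a (hd b)) a @ b @ drop (Suc (last_pos a (hd b))) a)
      else None)"

fun nest0 :: "'v vwalk option \<Rightarrow> 'v vwalk option \<Rightarrow> 'v vwalk option" (infixl \<open>\<odot>\<close> 70) where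
  "Some a \<odot> Some b = nest a b"
| "_ \<odot> _ = None"

text \<open>A nonzero nesting product with a trivial walk leaves the other factor unchanged.\<close>

lemma last_pos_nth:
  assumes "v \<in> set a"
  shows "last_pos a v < length a" "a ! last_pos a v = v"
proof -
  obtain i where "i < length a \<and> a ! i = v"
    using assms by (auto simp: in_set_conv_nth)
  then have "last_pos a v < length a \<and> a ! last_pos a v = v"
    unfolding last_pos_def by (rule GreatestI_nat[where b = "length a"]) auto
  then show "last_pos a v < length a" "a ! last_pos a v = v" by auto
qed

lemma nest_trivial_right: "nest a [v] = (if v \<in> set a then Some a else None)"
  using id_take_nth_drop[of "last_pos a v" a] last_pos_nth[of v a]
  by (auto simp: nest_def canonical_def cycle_off_def)

lemma nest_trivial_left: "nest [v] b = (if cycle_off v b then Some b else None)"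
proof -
  have "last_pos [v] v = 0"
    using last_pos_nth[of v "[v]"] by simp
  then show ?thesis
    by (auto simp: nest_def canonical_def cycle_off_def)
qed


section \<open>Divisibility, prime and irreducible walks\<close>

text \<open>
  The outer factors \<open>a\<close>, \<open>b\<close> are allowed to be absent.  For \<open>b\<close>, and for \<open>a\<close> when \<open>w'\<close> is a cycle,
  this is subsumed by trivial walks.  The last disjunct matters only for open \<open>w'\<close>: as
  \<open>nest a w'\<close> is zero for every open \<open>w'\<close>, without it an open walk would have no multiple at all,
  not even itself, and all open walks would be vacuously prime.
\<close>

definition divides :: "('v, 'e) pre_digraph \<Rightarrow> 'v vwalk \<Rightarrow> 'v vwalk \<Rightarrow> bool" where
  "divides G w' w \<longleftrightarrow>
     (\<exists>a b. vwalk a G \<and> vwalk b G \<and>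
        (Some w = (Some a \<odot> Some w') \<odot> Some b \<or> Some w = Some a \<odot> (Some w' \<odot> Some b))) \<or>
     (\<exists>b. vwalk b G \<and> Some w = Some w' \<odot> Some b)"

definition prime_walk :: "('v, 'e) pre_digraph \<Rightarrow> 'v vwalk \<Rightarrow> bool" where
  "prime_walk G w \<longleftrightarrow> vwalk w G \<and>
     (\<forall>a b c. vwalk a G \<longrightarrow> vwalk b G \<longrightarrow> Some a \<odot> Some b = Some c \<longrightarrow>
        divides G w c \<longrightarrow> divides G w a \<or> divides G w b)"

definition irreducible_walk :: "('v, 'e) pre_digraph \<Rightarrow> 'v vwalk \<Rightarrow> bool" where
  "irreducible_walk G w \<longleftrightarrow> vwalk w G \<and>
     (\<forall>a. vwalk a G \<longrightarrow> divides G a w \<longrightarrow> trivial_walk a \<or> a = w)"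


section \<open>Factorizations\<close>

text \<open>Parenthesized nesting products; \<open>factors\<close> is the set of leaves.\<close>

datatype (factors: 'w) nexpr = Factor 'w | Nest "'w nexpr" "'w nexpr"

fun nvalue :: "'v vwalk nexpr \<Rightarrow> 'v vwalk option" where
  "nvalue (Factor w) = Some w"
| "nvalue (Nest e f) = nvalue e \<odot> nvalue f"

definition factorization :: "('v, 'e) pre_digraph \<Rightarrow> 'v vwalk \<Rightarrow> 'v vwalk nexpr \<Rightarrow> bool" where
  "factorization G w e \<longleftrightarrow> (\<forall>f \<in> factors e. vwalk f G) \<and> nvalue e = Some w"

text \<open>
  Formal rearrangement: reordering of factors and parentheses, and insertion or deletion of
  trivial factors.  It does not respect \<^const>\<open>nvalue\<close>; that the walk is unmodified is imposed
  separately in \<open>equiv_fact\<close>.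
\<close>

inductive rearr :: "'v vwalk nexpr \<Rightarrow> 'v vwalk nexpr \<Rightarrow> bool" where
  refl: "rearr e e"
| sym: "rearr e f \<Longrightarrow> rearr f e"
| trans: "rearr e f \<Longrightarrow> rearr f g \<Longrightarrow> rearr e g"
| cong: "rearr e e' \<Longrightarrow> rearr f f' \<Longrightarrow> rearr (Nest e f) (Nest e' f')"
| swap: "rearr (Nest e f) (Nest f e)"
| assoc: "rearr (Nest (Nest e f) g) (Nest e (Nest f g))"
| triv: "trivial_walk u \<Longrightarrow> rearr (Nest e (Factor u)) e"

definition equiv_fact ::
    "('v, 'e) pre_digraph \<Rightarrow> 'v vwalk \<Rightarrow> 'v vwalk nexpr \<Rightarrow> 'v vwalk nexpr \<Rightarrow> bool" where
  "equiv_fact G w e e' \<longleftrightarrow> factorization G w e \<and> factorization G w e' \<and> rearr e e'"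

definition canonical_factorization ::
    "('v, 'e) pre_digraph \<Rightarrow> 'v vwalk \<Rightarrow> 'v vwalk nexpr \<Rightarrow> bool" where
  "canonical_factorization G w e \<longleftrightarrow>
     factorization G w e \<and> (\<forall>f \<in> factors e. simple_walk G f)"

definition factorization_into_primes ::
    "('v, 'e) pre_digraph \<Rightarrow> 'v vwalk \<Rightarrow> 'v vwalk nexpr \<Rightarrow> bool" where
  "factorization_into_primes G w e \<longleftrightarrow>
     factorization G w e \<and> (\<forall>f \<in> factors e. prime_walk G f)"

definition factorization_into_irreducibles ::
    "('v, 'e) pre_digraph \<Rightarrow> 'v vwalk \<Rightarrow> 'v vwalk nexpr \<Rightarrow> bool" where
  "factorization_into_irreducibles G w e \<longleftrightarrow>
     factorization G w e \<and> (\<forall>f \<in> factors e. irreducible_walk G f)"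


section \<open>The quiver near-algebra\<close>

text \<open>
  A (right) near-algebra is a linear space with a right-distributive multiplication that is
  homogeneous in its left argument.  Associativity is not required.
\<close>

definition near_algebra ::
    "('k :: field \<Rightarrow> 'a :: ab_group_add \<Rightarrow> 'a) \<Rightarrow> 'a set \<Rightarrow> ('a \<Rightarrow> 'a \<Rightarrow> 'a) \<Rightarrow> bool" where
  "near_algebra scale A mul \<longleftrightarrow>
     vector_space scale \<and> module.subspace scale A \<and>
     (\<forall>x\<in>A. \<forall>y\<in>A. mul x y \<in> A) \<and>
     (\<forall>x\<in>A. \<forall>y\<in>A. \<forall>z\<in>A. mul (x + y) z = mul x z + mul y z) \<and>
     (\<forall>c. \<forall>x\<in>A. \<forall>y\<in>A. mul (scale c x) y = scale c (mul x y))"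

definition kscale :: "'k :: field \<Rightarrow> ('w \<Rightarrow>\<^sub>0 'k) \<Rightarrow> ('w \<Rightarrow>\<^sub>0 'k)" where
  "kscale c x = Poly_Mapping.map ((*) c) x"

definition kbasis :: "'w \<Rightarrow> ('w \<Rightarrow>\<^sub>0 'k :: field)" where
  "kbasis w = Poly_Mapping.single w 1"

definition quiver_space :: "('v, 'e) pre_digraph \<Rightarrow> ('v vwalk \<Rightarrow>\<^sub>0 'k :: field) set" where
  "quiver_space G = {x. \<forall>w \<in> Poly_Mapping.keys x. vwalk w G}"

text \<open>
  A sum of walks is nonzero only if they share their initial and their final vertex.
  In a linear space with the walks as a basis this cannot be an identity between vectors
  (distinct basis vectors do not sum to zero), so the rule acts where a formal sum is used as the
  walk to be nested: \<open>parallel_sum y\<close> is the value of \<open>y\<close> under the rule, and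
  \<open>x \<odot> y = \<Sum>\<^sub>w x\<^sub>w (w \<odot> parallel_sum y)\<close>.  This is what makes the product right- but not
  left-distributive.
\<close>

definition parallel_sum :: "('v vwalk \<Rightarrow>\<^sub>0 'k :: field) \<Rightarrow> ('v vwalk \<Rightarrow>\<^sub>0 'k)" where
  "parallel_sum y =
     (if \<forall>u \<in> Poly_Mapping.keys y. \<forall>u' \<in> Poly_Mapping.keys y. hd u = hd u' \<and> last u = last u'
      then y else 0)"

definition kzero_or_walk :: "'w option \<Rightarrow> ('w \<Rightarrow>\<^sub>0 'k :: field)" where
  "kzero_or_walk r = (case r of None \<Rightarrow> 0 | Some w \<Rightarrow> kbasis w)"

definition knest ::
    "('v vwalk \<Rightarrow>\<^sub>0 'k :: field) \<Rightarrow> ('v vwalk \<Rightarrow>\<^sub>0 'k) \<Rightarrow> ('v vwalk \<Rightarrow>\<^sub>0 'k)" where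
  "knest x y =
     (\<Sum>w \<in> Poly_Mapping.keys x. \<Sum>u \<in> Poly_Mapping.keys (parallel_sum y).
        kscale (Poly_Mapping.lookup x w * Poly_Mapping.lookup (parallel_sum y) u)
          (kzero_or_walk (nest w u)))"

end

theory Submission
  imports Defs
begin

text \<open>
  Nesting \<open>b\<close> into \<open>a\<close> splices \<open>b\<close> into the vertex string of \<open>a\<close>, and canonicity forces any two
  cycles that were spliced into the same walk to be laminar.  Hence two products
  \<open>a \<odot> b = u \<odot> v\<close> always have a common refinement by a single walk \<open>r\<close>.
  Simple walks are exactly those that are not a product of two nontrivial walks, so primality of
  simple walks follows by refining an occurrence of \<open>w\<close> in \<open>a \<odot> b\<close>, and uniqueness of the multiset
  of nontrivial simple factors follows by refining the outermost products and inducting on the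
  length.
\<close>

section \<open>Nesting as splicing of vertex strings\<close>

lemma last_pos_append:
  assumes "v \<notin> set t"
  shows "last_pos (s @ v # t) v = length s"
  unfolding last_pos_def
proof (rule Greatest_equality)
  fix i assume i: "i < length (s @ v # t) \<and> (s @ v # t) ! i = v"
  show "i \<le> length s"
  proof (rule ccontr)
    assume "\<not> i \<le> length s"
    then have "(s @ v # t) ! i = t ! (i - length s - 1)" "i - length s - 1 < length t"
      using i by (auto simp: nth_append nth_Cons' less_diff_conv2)
    then show False using i assms by (metis nth_mem)
  qed
qed (simp add: nth_append)

text \<open>Exposing the last occurrence of \<open>v\<close> turns the index condition of
  \<open>canonical\<close> into one on sets. A cycle off \<open>v\<close> ends in that occurrence,
  hence \<open>t = []\<close>; \<open>hd (s @ [v])\<close> is its first vertex also for empty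
  \<open>s\<close>.\<close>

lemma nest_append:
  assumes "v \<notin> set t"
  shows "nest (s @ v # t) b = Some c \<and> hd b = v \<longleftrightarrow>
    b \<noteq> [] \<and> hd b = v \<and> last b = v \<and> c = s @ b @ t \<and>
    ((t = [] \<and> hd (s @ [v]) = v) \<or> (set s - {v}) \<inter> set b = {})"
proof -
  have cyc: "cycle_off v (s @ v # t) \<longleftrightarrow> t = [] \<and> hd (s @ [v]) = v"
    using assms by (cases s) (auto simp: cycle_off_def)
  have "(\<forall>i < length s. (s @ v # t) ! i \<noteq> v \<longrightarrow> (s @ v # t) ! i \<notin> set b)
      \<longleftrightarrow> (\<forall>i < length s. s ! i \<noteq> v \<longrightarrow> s ! i \<notin> set b)"
    by (auto simp: nth_append)
  also have "\<dots> \<longleftrightarrow> (\<forall>x\<in>set s. x \<noteq> v \<longrightarrow> x \<notin> set b)"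
    by (simp add: all_set_conv_all_nth)
  also have "\<dots> \<longleftrightarrow> (set s - {v}) \<inter> set b = {}"
    by blast
  finally have canon: "canonical (s @ v # t) b \<longleftrightarrow> b \<noteq> [] \<and> last b = v \<and>
      ((t = [] \<and> hd (s @ [v]) = v) \<or> (set s - {v}) \<inter> set b = {})" if "hd b = v"
    using that cyc by (simp add: canonical_def last_pos_append[OF assms] cycle_off_def[of _ b])
  have "nest (s @ v # t) b = (if canonical (s @ v # t) b then Some (s @ b @ t) else None)" if "hd b = v"
    using that by (simp add: nest_def last_pos_append[OF assms])
  then show ?thesis
    using canon by (cases "hd b = v") (simp_all split: if_split, blast+)
qed

lemma nestI:
  assumes "b \<noteq> []" "hd b = v" "last b = v" "v \<notin> set t"
    "(t = [] \<and> hd (s @ [v]) = v) \<or> (set s - {v}) \<inter> set b = {}"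
  shows "nest (s @ v # t) b = Some (s @ b @ t)"
  using assms nest_append[of v t s b "s @ b @ t"] by simp

lemma nest_iff:
  "nest a b = Some c \<longleftrightarrow>
    (\<exists>s t. b \<noteq> [] \<and> last b = hd b \<and> a = s @ hd b # t \<and> c = s @ b @ t \<and> hd b \<notin> set t \<and>
      ((t = [] \<and> hd (s @ [hd b]) = hd b) \<or> (set s - {hd b}) \<inter> set b = {}))"
proof
  assume *: "nest a b = Some c"
  then have "hd b \<in> set a"
    by (auto simp: nest_def canonical_def split: if_splits)
  then obtain s t where st: "a = s @ hd b # t" "hd b \<notin> set t"
    by (metis split_list_last)
  show "\<exists>s t. b \<noteq> [] \<and> last b = hd b \<and> a = s @ hd b # t \<and> c = s @ b @ t \<and> hd b \<notin> set t \<and>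
      ((t = [] \<and> hd (s @ [hd b]) = hd b) \<or> (set s - {hd b}) \<inter> set b = {})"
    using nest_append[OF st(2), of s b c] * st by (intro exI[of _ s] exI[of _ t]) simp
next
  assume "\<exists>s t. b \<noteq> [] \<and> last b = hd b \<and> a = s @ hd b # t \<and> c = s @ b @ t \<and> hd b \<notin> set t \<and>
      ((t = [] \<and> hd (s @ [hd b]) = hd b) \<or> (set s - {hd b}) \<inter> set b = {})"
  then show "nest a b = Some c"
    by (auto intro: nestI)
qed

lemma nest_nonempty: "nest a b = Some c \<Longrightarrow> a \<noteq> [] \<and> b \<noteq> [] \<and> c \<noteq> []"
  unfolding nest_iff by auto

text \<open>Edges add up, and a walk has one vertex more than edges. So a factor is strictly shorter
  than the product whenever the other factor is nontrivial.\<close>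

lemma length_nest: "nest a b = Some c \<Longrightarrow> Suc (length c) = length a + length b"
  unfolding nest_iff by auto

lemma vwalk_append_iff:
  "vwalk (p @ v # q) G \<longleftrightarrow> vwalk (p @ [v]) G \<and> vwalk (v # q) G"
proof (induction p)
  case Nil
  show ?case by (cases q) (auto simp: vwalk_def)
next
  case (Cons x p)
  have "vwalk (x # r) G \<longleftrightarrow> x \<in> verts G \<and> (x, hd r) \<in> arcs_ends G \<and> vwalk r G" if "r \<noteq> []" for r
    using that by (auto simp: vwalk_def)
  from this[of "p @ v # q"] this[of "p @ [v]"] show ?case
    using Cons by (cases p) auto
qed

text \<open>\<open>b\<close> starts and ends at the same vertex, so \<open>c\<close> can be cut
  there on both sides of \<open>b\<close>, and the outer pieces glue back to \<open>a\<close>. Read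
  from \<open>c\<close>, this makes every factor of a walk a walk.\<close>

lemma vwalk_nest:
  assumes "nest a b = Some c"
  shows "vwalk c G \<longleftrightarrow> vwalk a G \<and> vwalk b G"
proof -
  obtain s t where st: "b \<noteq> []" "last b = hd b" "a = s @ hd b # t" "c = s @ b @ t"
    using assms unfolding nest_iff by blast
  let ?v = "hd b"
  have bl: "butlast b @ [?v] = b"
    using st by (metis append_butlast_last_id)
  then have "?v # tl b @ t = butlast b @ ?v # t" "c = s @ ?v # tl b @ t"
    using st by (metis append_eq_append_conv2 append_Cons append_assoc append_Nil list.collapse)+
  then have "vwalk c G \<longleftrightarrow> vwalk (s @ [?v]) G \<and> vwalk b G \<and> vwalk (?v # t) G"
    using vwalk_append_iff[of s ?v "tl b @ t" G] vwalk_append_iff[of "butlast b" ?v t G] bl by metis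
  then show ?thesis
    using vwalk_append_iff[of s ?v t G] st by auto
qed


section \<open>Refinement of two nesting products\<close>

text \<open>Here \<open>b\<close> ends strictly before \<open>v\<close> does. Then \<open>b\<close>
  lies inside \<open>v\<close>, or the two occupy disjoint stretches of the string, or they overlap
  partially, which canonicity forbids.\<close>

lemma nest_refinement_later:
  assumes "b \<noteq> []" "last b = hd b" "hd b \<notin> set t"
    "(t = [] \<and> hd (s @ [hd b]) = hd b) \<or> (set s - {hd b}) \<inter> set b = {}"
    and "v \<noteq> []" "last v = hd v" "hd v \<notin> set t'"
    "(t' = [] \<and> hd (s' @ [hd v]) = hd v) \<or> (set s' - {hd v}) \<inter> set v = {}"
    and eq: "s @ b @ t = s' @ v @ t'"
    and t: "t = n @ t'" "n \<noteq> []"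
  shows "(\<exists>r. nest r b = Some v \<and> nest (s' @ hd v # t') r = Some (s @ hd b # t)) \<or>
    (\<exists>r. nest r b = Some (s' @ hd v # t') \<and> nest r v = Some (s @ hd b # t))"
proof -
  let ?\<beta> = "hd b" and ?\<gamma> = "hd v"
  have disj: "(set s - {?\<beta>}) \<inter> set b = {}" using assms(4) t by auto
  have eq': "s @ b @ n = s' @ v" using eq t by simp
  have last_n: "last n = ?\<gamma>"
    using eq' t(2) assms(5,6) by (metis append_is_Nil_conv last_appendR)
  \<comment> \<open>The base point of \<open>v\<close> ends \<open>n\<close>, a part of
    \<open>t\<close>, where the base point of \<open>b\<close> does not occur.\<close>
  then have ne: "?\<gamma> \<noteq> ?\<beta>" using assms(3) t last_in_set[of n] by auto
  from eq' consider m where "s = s' @ m" "v = m @ b @ n" | m where "s' = s @ m" "b @ n = m @ v"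
    by (auto simp: append_eq_append_conv2)
  then show ?thesis
  proof cases
    case 1
    have m: "m \<noteq> []" using 1 ne assms(1) by auto
    \<comment> \<open>The required \<open>r\<close> is \<open>v\<close> with \<open>b\<close>
      contracted to its base point.\<close>
    have "nest (m @ ?\<beta> # n) b = Some v"
      unfolding 1(2) by (rule nestI) (use 1 t assms(1-3) disj in auto)
    moreover have "nest (s' @ ?\<gamma> # t') (m @ ?\<beta> # n) = Some (s' @ (m @ ?\<beta> # n) @ t')"
    proof (rule nestI)
      show "hd (m @ hd b # n) = hd v" using 1 m by simp
      have "set (m @ hd b # n) \<subseteq> set v" using 1 assms(1) by auto
      then show "t' = [] \<and> hd (s' @ [hd v]) = hd v \<or> (set s' - {hd v}) \<inter> set (m @ hd b # n) = {}"
        using assms(8) by blast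
    qed (use last_n t assms in auto)
    ultimately show ?thesis using 1 t by auto
  next
    case 2
    have m: "m \<noteq> []" using 2 ne assms(1) by auto
    from 2 consider k where "m = b @ k" "n = k @ v" | l where "b = m @ l" "v = l @ n" "l \<noteq> []"
      unfolding append_eq_append_conv2 by (metis append_Nil append_Nil2)
    then show ?thesis
    proof cases
      case 1
      \<comment> \<open>For disjoint stretches, \<open>r\<close> has both cycles contracted.
        Contracting \<open>b\<close> keeps the first vertex of the walk, so the cycle alternative
        for \<open>v\<close> survives.\<close>
      have "nest (s @ ?\<beta> # (k @ ?\<gamma> # t')) b = Some (s @ b @ (k @ ?\<gamma> # t'))"
        by (rule nestI) (use assms(1-3) disj ne t 1 in auto)
      moreover have "nest ((s @ ?\<beta> # k) @ ?\<gamma> # t') v = Some ((s @ ?\<beta> # k) @ v @ t')"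
      proof (rule nestI)
        show "t' = [] \<and> hd ((s @ hd b # k) @ [hd v]) = hd v \<or> (set (s @ hd b # k) - {hd v}) \<inter> set v = {}"
          using assms(1,8) 2 1 by (cases s; cases b) auto
      qed (use assms in auto)
      ultimately show ?thesis using 1 2 t by auto
    next
      case l: 2
      \<comment> \<open>Under partial overlap each base point lies on the other cycle. So
        \<open>v\<close> can only be canonical by the cycle alternative; then the walk starts at the
        base point of \<open>v\<close>, which puts this vertex of \<open>b\<close> into
        \<open>s\<close>, against \<open>disj\<close>.\<close>
      have "?\<beta> \<in> set v" "?\<gamma> \<in> set b" "?\<beta> \<in> set s'"
        using l assms(2) 2 m last_in_set[of l] by (auto simp: hd_append)
      then have t': "t' = []" "hd (s' @ [?\<gamma>]) = ?\<gamma>"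
        using assms(8) ne by auto
      then have "?\<gamma> \<in> set s"
        using 2 l ne by (cases s) (auto simp: hd_append split: if_splits)
      then show ?thesis using disj ne \<open>?\<gamma> \<in> set b\<close> by auto
    qed
  qed
qed

text \<open>Cycles ending at the same place share their base point. The part of \<open>b\<close>
  before \<open>v\<close>, closed off by that vertex, is again a cycle off it, and two cycles off
  one vertex always nest.\<close>

lemma nest_refinement_same_end:
  assumes "last b = hd b" "hd b \<notin> set t"
    "(t = [] \<and> hd (s @ [hd b]) = hd b) \<or> (set s - {hd b}) \<inter> set b = {}"
    and "v \<noteq> []" "last v = hd v"
    and s': "s' = s @ m" "b = m @ v"
  shows "nest (m @ [hd v]) v = Some b \<and> nest (s @ hd b # t) (m @ [hd v]) = Some (s' @ hd v # t)"
proof -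
  have v: "hd b = hd v" using assms by auto
  have "nest (m @ [hd v]) v = Some (m @ v @ [])"
    by (rule nestI) (use assms v in \<open>auto simp: hd_append\<close>)
  moreover have "nest (s @ hd b # t) (m @ [hd v]) = Some (s @ (m @ [hd v]) @ t)"
    by (rule nestI) (use assms v in \<open>auto simp: hd_append\<close>)
  ultimately show ?thesis using s' by auto
qed

text \<open>
  Two nested cycles of the same walk are laminar: they are disjoint or one contains the other.
  The three alternatives say that \<open>v\<close> lies inside \<open>b\<close>, that \<open>b\<close> lies inside \<open>v\<close>, and that both
  can be removed independently.
\<close>

proposition nest_refinement:
  assumes "nest a b = Some c" "nest u v = Some c"
  shows "(\<exists>r. nest r v = Some b \<and> nest a r = Some u) \<or>
    (\<exists>r. nest r b = Some v \<and> nest u r = Some a) \<or>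
    (\<exists>r. nest r b = Some u \<and> nest r v = Some a)"
proof -
  obtain s t where b: "b \<noteq> []" "last b = hd b" "hd b \<notin> set t"
    "(t = [] \<and> hd (s @ [hd b]) = hd b) \<or> (set s - {hd b}) \<inter> set b = {}"
    and c1: "a = s @ hd b # t" "c = s @ b @ t"
    using assms(1) unfolding nest_iff by blast
  obtain s' t' where v: "v \<noteq> []" "last v = hd v" "hd v \<notin> set t'"
    "(t' = [] \<and> hd (s' @ [hd v]) = hd v) \<or> (set s' - {hd v}) \<inter> set v = {}"
    and c2: "u = s' @ hd v # t'" "c = s' @ v @ t'"
    using assms(2) unfolding nest_iff by blast
  have eq: "s @ b @ t = s' @ v @ t'" using c1 c2 by simp
  then have "(s @ b) @ t = (s' @ v) @ t'" by simp
  \<comment> \<open>The cases are that \<open>b\<close> ends first, that \<open>v\<close> ends first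
    (the mirror image), and that both end together, so that one is a suffix of the other.\<close>
  then consider n where "t = n @ t'" "n \<noteq> []" | n where "t' = n @ t" "n \<noteq> []" | "t = t'"
    unfolding append_eq_append_conv2 by (metis append_Nil)
  then show ?thesis
  proof cases
    case 1
    from nest_refinement_later[OF b v eq 1] show ?thesis using c1 c2 by blast
  next
    case 2
    from nest_refinement_later[OF v b eq[symmetric] 2] show ?thesis using c1 c2 by blast
  next
    case 3
    then have "s @ b = s' @ v" using eq by simp
    then consider m where "s' = s @ m" "b = m @ v" | m where "s = s' @ m" "v = m @ b"
      by (auto simp: append_eq_append_conv2)
    then show ?thesis
    proof cases
      case 1
      from nest_refinement_same_end[OF b(2-4) v(1,2) 1] show ?thesis using c1 c2 3 by blast
    next
      case 2
      from nest_refinement_same_end[OF v(2-4) b(1,2) 2] show ?thesis using c1 c2 3 by blast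
    qed
  qed
qed

section \<open>Simple walks, divisibility and primality\<close>

lemma trivial_walk_iff: "trivial_walk w \<longleftrightarrow> length w \<le> 1"
  by (auto simp: trivial_walk_def)

lemma nest_trivialR: "nest a b = Some c \<Longrightarrow> trivial_walk b \<Longrightarrow> c = a"
  using nest_nonempty[of a b c] nest_trivial_right[of a "hd b"]
  by (cases b) (auto simp: trivial_walk_iff split: if_splits)

lemma nest_trivialL: "nest a b = Some c \<Longrightarrow> trivial_walk a \<Longrightarrow> c = b"
  using nest_nonempty[of a b c] nest_trivial_left[of "hd a" b]
  by (cases a) (auto simp: trivial_walk_iff split: if_splits)

lemma nest_trivial_iff:
  "nest a b = Some c \<Longrightarrow> trivial_walk c \<longleftrightarrow> trivial_walk a \<and> trivial_walk b"
  using length_nest[of a b c] nest_nonempty[of a b c]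
  by (cases a; cases b) (auto simp: trivial_walk_iff)

text \<open>Every walk has a right unit, whereas only cycles have a left one. This fills in absent
  right factors in \<open>divides\<close>.\<close>

lemma nest_self_right: "w \<noteq> [] \<Longrightarrow> nest w [hd w] = Some w"
  by (simp add: nest_trivial_right)

lemma vwalk_nonempty: "vwalk w G \<Longrightarrow> w \<noteq> []"
  by (auto simp: vwalk_def)

lemma simple_walk_vwalk: "simple_walk G w \<Longrightarrow> vwalk w G"
  by (auto simp: simple_walk_def simple_cycle_def vpath_def)

text \<open>A nontrivial \<open>b\<close> puts its base point into \<open>c\<close> twice, so
  \<open>c\<close> is no path. A nontrivial \<open>a\<close> adds a vertex before or after
  \<open>b\<close>, which makes one copy internal, so \<open>c\<close> is no simple cycle
  either.\<close>

lemma simple_walk_nest: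
  assumes "simple_walk G c" "nest a b = Some c"
  shows "trivial_walk a \<or> trivial_walk b"
proof (rule ccontr)
  assume *: "\<not> (trivial_walk a \<or> trivial_walk b)"
  obtain s t where st: "b \<noteq> []" "last b = hd b" "a = s @ hd b # t" "c = s @ b @ t"
    using assms(2) unfolding nest_iff by blast
  obtain v m where b: "b = v # m @ [v]"
    using * st by (cases b; cases "tl b" rule: rev_cases) (auto simp: trivial_walk_iff)
  have "s \<noteq> [] \<or> t \<noteq> []" using * st by (auto simp: trivial_walk_iff)
  then show False
    using assms(1) st b
    by (cases s; cases t rule: rev_cases)
      (auto simp: simple_walk_def vpath_def simple_cycle_def cycle_off_def butlast_append)
qed

section \<open>Splitting walks that are not simple\<close>

text \<open>Either the head recurs, and its last occurrence closes the segment, or it is absent from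
  the tail and can be prepended to \<open>s\<close>.\<close>

lemma first_recurring_vertex:
  assumes "\<not> distinct w"
  obtains s v m t where "w = s @ v # m @ v # t" "v \<notin> set t" "set s \<inter> set (v # m) = {}"
proof -
  have "\<exists>s v m t. w = s @ v # m @ v # t \<and> v \<notin> set t \<and> set s \<inter> set (v # m) = {}"
    using assms
  proof (induction w)
    case (Cons x w)
    show ?case
    proof (cases "x \<in> set w")
      case True
      then obtain m t where "w = m @ x # t" "x \<notin> set t" by (metis split_list_last)
      then show ?thesis
        by (intro exI[of _ "[]"] exI[of _ x] exI[of _ m] exI[of _ t]) simp
    next
      case False
      then obtain s v m t where "w = s @ v # m @ v # t" "v \<notin> set t" "set s \<inter> set (v # m) = {}"
        using Cons by auto
      then show ?thesis using False
        by (intro exI[of _ "x # s"] exI[of _ v] exI[of _ m] exI[of _ t]) auto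
    qed
  qed simp
  then show thesis using that by blast
qed

text \<open>
  The cycle split off starts at the first vertex that recurs and runs to its last occurrence:
  no earlier vertex lies on it, which is what canonicity asks for.  If this cycle is all of \<open>w\<close>,
  then \<open>w\<close> is either a concatenation of two cycles or has a recurring internal vertex.
\<close>

lemma nest_decomposition:
  assumes "vwalk w G" "\<not> simple_walk G w"
  obtains a b where "nest a b = Some w" "\<not> trivial_walk a" "\<not> trivial_walk b"
proof -
  have "\<not> distinct w" using assms by (auto simp: simple_walk_def vpath_def)
  then obtain s v m t where w: "w = s @ v # m @ v # t" "v \<notin> set t" "set s \<inter> set (v # m) = {}"
    by (rule first_recurring_vertex)
  show thesis
  proof (cases "s = [] \<and> t = []")
    case False
    have "nest (s @ v # t) (v # m @ [v]) = Some (s @ (v # m @ [v]) @ t)"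
      by (rule nestI) (use w in auto)
    with False show thesis
      by (intro that[of "s @ v # t" "v # m @ [v]"]) (auto simp: w trivial_walk_iff)
  next
    case True
    show thesis
    proof (cases "v \<in> set m")
      case v: True
      then obtain m1 m2 where m: "m = m1 @ v # m2" by (metis split_list)
      have "nest ((v # m1) @ v # []) (v # m2 @ [v]) = Some ((v # m1) @ (v # m2 @ [v]) @ [])"
        by (rule nestI) auto
      with True m show thesis
        by (intro that[of "v # m1 @ [v]" "v # m2 @ [v]"]) (auto simp: w trivial_walk_iff)
    next
      case v: False
      then have "\<not> distinct m"
        using assms w True by (auto simp: simple_walk_def simple_cycle_def cycle_off_def butlast_append)
      then obtain s' x m' t' where m: "m = s' @ x # m' @ x # t'" "x \<notin> set t'"
        "set s' \<inter> set (x # m') = {}"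
        by (rule first_recurring_vertex)
      \<comment> \<open>The prefix \<open>v # s'\<close> avoids the cycle at \<open>x\<close>:
        \<open>v\<close> is not in \<open>m\<close>, and \<open>s'\<close> is disjoint from
        \<open>x # m'\<close>.\<close>
      have "nest ((v # s') @ x # (t' @ [v])) (x # m' @ [x]) = Some ((v # s') @ (x # m' @ [x]) @ t' @ [v])"
        by (rule nestI) (use m v in auto)
      with True m show thesis
        by (intro that[of "v # s' @ x # t' @ [v]" "x # m' @ [x]"]) (auto simp: w trivial_walk_iff)
    qed
  qed
qed

section \<open>Divisors of a walk\<close>

lemma dividesI_left:
  "nest x w = Some z \<Longrightarrow> nest z y = Some c \<Longrightarrow> vwalk c G \<Longrightarrow> divides G w c"
  unfolding divides_def using vwalk_nest by (metis nest0.simps(1))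

lemma dividesI_right:
  "nest w y = Some z \<Longrightarrow> nest x z = Some c \<Longrightarrow> vwalk c G \<Longrightarrow> divides G w c"
  unfolding divides_def using vwalk_nest by (metis nest0.simps(1))

lemma dividesI_head: "nest w y = Some c \<Longrightarrow> vwalk c G \<Longrightarrow> divides G w c"
  unfolding divides_def using vwalk_nest by (metis nest0.simps(1))

lemma dividesI_tail: "nest x w = Some c \<Longrightarrow> vwalk c G \<Longrightarrow> divides G w c"
  using dividesI_left nest_self_right vwalk_nonempty by blast

lemma divides_self: "vwalk w G \<Longrightarrow> divides G w w"
  using dividesI_head nest_self_right vwalk_nonempty by blast

lemma dividesE:
  assumes "divides G w c"
  obtains (left) x y z where "nest x w = Some z" "nest z y = Some c"
  | (right) x y z where "nest w y = Some z" "nest x z = Some c"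
  | (head) y where "nest w y = Some c"
proof -
  have "\<exists>z. p = Some z \<and> nest z y = Some c" if "Some c = p \<odot> Some y" for p y
    using that by (cases p) auto
  moreover have "\<exists>z. p = Some z \<and> nest x z = Some c" if "Some c = Some x \<odot> p" for p x
    using that by (cases p) auto
  ultimately show thesis
    using assms left right head unfolding divides_def by (metis nest0.simps(1))
qed

lemma divides_length: "divides G w c \<Longrightarrow> length w \<le> length c"
proof -
  have le: "length a \<le> length c \<and> length b \<le> length c" if "nest a b = Some c" for a b c :: "'a list"
    using length_nest[OF that] nest_nonempty[OF that] by (cases a; cases b) auto
  assume "divides G w c"
  then show ?thesis by (cases rule: dividesE) (use le in \<open>meson order.trans\<close>)+
qed

section \<open>Irreducible and prime walks are the simple walks\<close>

text \<open>A walk that is not simple has a nontrivial divisor \<open>b\<close> shorter than itself.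
  A simple walk only splits off trivial factors, at the outer and then at the inner product of a
  divisibility.\<close>

lemma irreducible_walk_iff: "irreducible_walk G w \<longleftrightarrow> simple_walk G w"
proof
  assume irr: "irreducible_walk G w"
  then have w: "vwalk w G" by (simp add: irreducible_walk_def)
  show "simple_walk G w"
  proof (rule ccontr)
    assume "\<not> simple_walk G w"
    with w obtain a b where ab: "nest a b = Some w" "\<not> trivial_walk a" "\<not> trivial_walk b"
      by (rule nest_decomposition)
    then have "divides G b w" "vwalk b G" using w dividesI_tail vwalk_nest by blast+
    then have "b = w" using irr ab by (auto simp: irreducible_walk_def)
    then show False using length_nest[OF ab(1)] ab by (auto simp: trivial_walk_iff)
  qed
next
  assume w: "simple_walk G w"
  have "trivial_walk a \<or> a = w" if "divides G a w" for a
    using that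
  proof (cases rule: dividesE)
    case (left x y z)
    then show ?thesis
      using simple_walk_nest[OF w] nest_trivial_iff nest_trivialR nest_trivialL w
      by (metis simple_walk_nest)
  next
    case (right x y z)
    then show ?thesis
      using simple_walk_nest[OF w] nest_trivial_iff nest_trivialR nest_trivialL w
      by (metis simple_walk_nest)
  next
    case (head y)
    then show ?thesis using simple_walk_nest[OF w] nest_trivialR by blast
  qed
  then show "irreducible_walk G w"
    using simple_walk_vwalk[OF w] by (simp add: irreducible_walk_def)
qed

text \<open>If \<open>w\<close> is a product of two nontrivial walks, it divides that product but
  neither factor, both being shorter.\<close>

lemma prime_walk_simple:
  assumes "prime_walk G w"
  shows "simple_walk G w"
proof (rule ccontr)
  assume "\<not> simple_walk G w"
  moreover have w: "vwalk w G" using assms by (simp add: prime_walk_def)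
  ultimately obtain a b where ab: "nest a b = Some w" "\<not> trivial_walk a" "\<not> trivial_walk b"
    using nest_decomposition by blast
  then have "divides G w a \<or> divides G w b"
    using assms divides_self[OF w] vwalk_nest[OF ab(1), of G] w ab(1) unfolding prime_walk_def
    by (metis nest0.simps(1))
  then show False
    using divides_length[of G w a] divides_length[of G w b] length_nest[OF ab(1)] ab(2,3)
    by (auto simp: trivial_walk_iff)
qed

lemma nest_simple_cases:
  assumes "simple_walk G w" "nest r s = Some w"
  shows "s = w \<or> r = w \<and> trivial_walk s"
  using simple_walk_nest[OF assms] nest_trivialR[OF assms(2)] nest_trivialL[OF assms(2)] by blast

text \<open>The first alternative says more than divisibility: with \<open>w\<close> as left factor
  of \<open>a\<close>, a further walk can still be put in front by
  \<open>dividesI_right\<close>.\<close>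

lemma simple_walk_divides_left_factor:
  assumes w: "simple_walk G w" and a: "vwalk a G" and b: "vwalk b G"
    and ab: "nest a b = Some z" and wy: "nest w y = Some z"
  shows "(\<exists>s. nest w s = Some a) \<or> divides G w b"
proof -
  have self: "\<exists>s. nest w s = Some w"
    using nest_self_right vwalk_nonempty simple_walk_vwalk[OF w] by blast
  from nest_refinement[OF ab wy] consider
      r where "nest r y = Some b" "nest a r = Some w"
    | r where "nest r b = Some y" "nest w r = Some a"
    | r where "nest r b = Some w" "nest r y = Some a"
    by blast
  then show ?thesis
  proof cases
    case (1 r)
    then show ?thesis
      using nest_simple_cases[OF w 1(2)] dividesI_head[OF _ b] self by blast
  next
    case (3 r)
    then show ?thesis
      using nest_simple_cases[OF w 3(1)] divides_self[OF b] by blast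
  qed blast
qed

text \<open>The product of \<open>a\<close> and \<open>b\<close> is refined against the outer
  product of the divisibility, then against the inner one. A refinement that would cut through
  \<open>w\<close> makes \<open>w\<close> equal to one of its parts, by
  \<open>nest_simple_cases\<close>.\<close>

lemma simple_walk_prime:
  assumes w: "simple_walk G w"
  shows "prime_walk G w"
  unfolding prime_walk_def
proof (intro conjI allI impI)
  show "vwalk w G" using simple_walk_vwalk[OF w] .
  fix a b c
  assume a: "vwalk a G" and b: "vwalk b G" and "Some a \<odot> Some b = Some c" and div: "divides G w c"
  then have ab: "nest a b = Some c" by simp
  from div show "divides G w a \<or> divides G w b"
  proof (cases rule: dividesE)
    case (left x y z)
    from nest_refinement[OF ab left(2)] consider
        r where "nest r y = Some b" "nest a r = Some z"
      | r where "nest r b = Some y" "nest z r = Some a"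
      | r where "nest r b = Some z" "nest r y = Some a"
      by blast
    then show ?thesis
    proof cases
      case (1 r)
      from nest_refinement[OF 1(2) left(1)] consider
          s where "nest s w = Some r" "nest a s = Some x"
        | s where "nest s r = Some w" "nest x s = Some a"
        | s where "nest s r = Some x" "nest s w = Some a"
        by blast
      then show ?thesis
      proof cases
        case (1 s)
        then show ?thesis using \<open>nest r y = Some b\<close> dividesI_left b by blast
      next
        \<comment> \<open>Here \<open>w\<close> straddles \<open>a\<close> and \<open>b\<close>:
          either \<open>r = w\<close> begins \<open>b\<close>, or \<open>s = w\<close> is nested
          into \<open>x\<close> to give \<open>a\<close>.\<close>
        case (2 s)
        then show ?thesis
          using nest_simple_cases[OF w 2(1)] \<open>nest r y = Some b\<close> dividesI_head[OF _ b]
            dividesI_tail[OF _ a] by blast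
      next
        case (3 s)
        then show ?thesis using dividesI_tail a by blast
      qed
    next
      case (2 r)
      then show ?thesis using left(1) dividesI_left a by blast
    next
      case (3 r)
      from nest_refinement[OF 3(1) left(1)] consider
          s where "nest s w = Some b" "nest r s = Some x"
        | s where "nest s b = Some w" "nest x s = Some r"
        | s where "nest s b = Some x" "nest s w = Some r"
        by blast
      then show ?thesis
      proof cases
        case (1 s)
        then show ?thesis using dividesI_tail b by blast
      next
        case (2 s)
        then show ?thesis
          using nest_simple_cases[OF w 2(1)] divides_self[OF b] \<open>nest r y = Some a\<close>
            dividesI_left[OF _ _ a] by blast
      next
        case (3 s)
        then show ?thesis using \<open>nest r y = Some a\<close> dividesI_left a by blast
      qed
    qed
  next
    case (right x y z)
    from nest_refinement[OF ab right(2)] consider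
        r where "nest r z = Some b" "nest a r = Some x"
      | r where "nest r b = Some z" "nest x r = Some a"
      | r where "nest r b = Some x" "nest r z = Some a"
      by blast
    then show ?thesis
    proof cases
      case (1 r)
      then show ?thesis using right(1) dividesI_right b by blast
    next
      case (2 r)
      have "vwalk r G" using vwalk_nest[OF 2(2)] a by blast
      from simple_walk_divides_left_factor[OF w this b 2(1) right(1)] show ?thesis
        using 2(2) dividesI_right a by blast
    next
      case (3 r)
      then show ?thesis using right(1) dividesI_right a by blast
    qed
  next
    case (head y)
    from simple_walk_divides_left_factor[OF w a b ab head] show ?thesis
      using dividesI_head a by blast
  qed
qed

lemma prime_walk_iff: "prime_walk G w \<longleftrightarrow> simple_walk G w"
  using prime_walk_simple simple_walk_prime by blast


section \<open>Uniqueness of canonical factorizations\<close>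

text \<open>Multiplicities are kept and trivial factors dropped, as under \<open>rearr\<close>;
  equal multisets yield a rearrangement in \<open>rearrI\<close>.\<close>

fun nontrivial_factors :: "'v vwalk nexpr \<Rightarrow> 'v vwalk multiset" where
  "nontrivial_factors (Factor w) = (if trivial_walk w then {#} else {#w#})"
| "nontrivial_factors (Nest e f) = nontrivial_factors e + nontrivial_factors f"

lemma set_nontrivial_factors: "set_mset (nontrivial_factors e) = {f \<in> factors e. \<not> trivial_walk f}"
  by (induction e) auto

lemma canonical_factorization_Factor:
  "canonical_factorization G w (Factor u) \<longleftrightarrow> u = w \<and> simple_walk G w"
  using simple_walk_vwalk by (auto simp: canonical_factorization_def factorization_def)

lemma canonical_factorization_Nest:
  "canonical_factorization G w (Nest e f) \<longleftrightarrow>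
    (\<exists>a b. canonical_factorization G a e \<and> canonical_factorization G b f \<and> nest a b = Some w)"
  by (cases "nvalue e"; cases "nvalue f") (auto simp: canonical_factorization_def factorization_def)

lemma canonical_factorization_exists:
  "vwalk w G \<Longrightarrow> \<exists>e. canonical_factorization G w e"
proof (induction "length w" arbitrary: w rule: less_induct)
  case less
  show ?case
  proof (cases "simple_walk G w")
    case True
    then show ?thesis using canonical_factorization_Factor by blast
  next
    case False
    with less.prems obtain a b where ab: "nest a b = Some w" "\<not> trivial_walk a" "\<not> trivial_walk b"
      by (rule nest_decomposition)
    then have "length a < length w" "length b < length w" "vwalk a G" "vwalk b G"
      using length_nest[OF ab(1)] vwalk_nest[OF ab(1), of G] less.prems by (auto simp: trivial_walk_iff)
    then show ?thesis using less.hyps ab(1) canonical_factorization_Nest by metis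
  qed
qed

text \<open>Trivial factors are peeled off at the root until both factors of the outermost product
  are nontrivial. So \<open>e1\<close> and \<open>e2\<close> may sit deeper in
  \<open>e\<close>.\<close>

lemma canonical_factorization_cases:
  assumes "canonical_factorization G w e"
  obtains (trivial) "trivial_walk w" "nontrivial_factors e = {#}"
  | (simple) "\<not> trivial_walk w" "simple_walk G w" "nontrivial_factors e = {#w#}"
  | (nest) a b e1 e2 where "nest a b = Some w" "\<not> trivial_walk a" "\<not> trivial_walk b"
      "canonical_factorization G a e1" "canonical_factorization G b e2"
      "nontrivial_factors e = nontrivial_factors e1 + nontrivial_factors e2"
proof -
  have triv: "nontrivial_factors g = {#}" if "canonical_factorization G v g" "trivial_walk v" for v g
    using that
  proof (induction g arbitrary: v)
    case (Nest g h)
    then show ?case unfolding canonical_factorization_Nest using nest_trivial_iff by fastforce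
  qed (auto simp: canonical_factorization_Factor)
  let ?P = "\<lambda>w e. (trivial_walk w \<and> nontrivial_factors e = {#}) \<or>
    (\<not> trivial_walk w \<and> simple_walk G w \<and> nontrivial_factors e = {#w#}) \<or>
    (\<exists>a b e1 e2. nest a b = Some w \<and> \<not> trivial_walk a \<and> \<not> trivial_walk b \<and>
      canonical_factorization G a e1 \<and> canonical_factorization G b e2 \<and>
      nontrivial_factors e = nontrivial_factors e1 + nontrivial_factors e2)"
  have "?P w e"
    using assms
  proof (induction e arbitrary: w)
    case (Factor u)
    then show ?case
      by (cases "trivial_walk w") (auto simp: canonical_factorization_Factor)
  next
    case (Nest e f)
    obtain a b where ab: "canonical_factorization G a e" "canonical_factorization G b f"
      "nest a b = Some w"
      using Nest.prems unfolding canonical_factorization_Nest by blast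
    consider "trivial_walk b" | "trivial_walk a" | "\<not> trivial_walk a" "\<not> trivial_walk b" by blast
    then show ?case
    proof cases
      case 1
      have "w = a" "nontrivial_factors (Nest e f) = nontrivial_factors e"
        using nest_trivialR[OF ab(3) 1] triv[OF ab(2) 1] by auto
      with Nest.IH(1)[OF ab(1)] show ?thesis by presburger
    next
      case 2
      have "w = b" "nontrivial_factors (Nest e f) = nontrivial_factors f"
        using nest_trivialL[OF ab(3) 2] triv[OF ab(1) 2] by auto
      with Nest.IH(2)[OF ab(2)] show ?thesis by presburger
    next
      case 3
      with ab show ?thesis
        by (intro disjI2) (intro exI[of _ a] exI[of _ b] exI[of _ e] exI[of _ f], simp)
    qed
  qed
  then show thesis using trivial simple nest by blast
qed

text \<open>The outermost products of the two factorizations share a refining walk \<open>r\<close>.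
  Any canonical factorization of \<open>r\<close> completes to one of a shorter factor on each side,
  where the induction hypothesis applies.\<close>

lemma nontrivial_factors_unique:
  assumes "canonical_factorization G w e" "canonical_factorization G w e'"
  shows "nontrivial_factors e = nontrivial_factors e'"
  using assms
proof (induction "length w" arbitrary: w e e' rule: less_induct)
  case less
  have vwalk_cf: "vwalk v G" if "canonical_factorization G v g" for v g
    using that
  proof (induction g arbitrary: v)
    case (Nest g h)
    then show ?case unfolding canonical_factorization_Nest using vwalk_nest by metis
  qed (auto simp: canonical_factorization_Factor simple_walk_vwalk)
  have nontriv: "\<not> trivial_walk w" "\<not> simple_walk G w"
    if "nest a b = Some w" "\<not> trivial_walk a" "\<not> trivial_walk b" for a b
    using that simple_walk_nest nest_trivial_iff by blast+
  have shorter: "length a < length w \<and> length b < length w"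
    if "nest a b = Some w" "\<not> trivial_walk a" "\<not> trivial_walk b" for a b
    using length_nest[OF that(1)] that by (auto simp: trivial_walk_iff)
  from less.prems(1) show ?case
  proof (cases rule: canonical_factorization_cases)
    case trivial
    from less.prems(2) show ?thesis
    proof (cases rule: canonical_factorization_cases)
      case (nest a b e1 e2)
      then show ?thesis using nontriv[OF nest(1-3)] trivial by simp
    qed (use trivial in simp_all)
  next
    case simple
    from less.prems(2) show ?thesis
    proof (cases rule: canonical_factorization_cases)
      case (nest a b e1 e2)
      then show ?thesis using nontriv[OF nest(1-3)] simple by simp
    qed (use simple in simp_all)
  next
    case 1: (nest a b e1 e2)
    note sh1 = shorter[OF 1(1-3)]
    from less.prems(2) show ?thesis
    proof (cases rule: canonical_factorization_cases)
      case 2: (nest u v f1 f2)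
      note sh2 = shorter[OF 2(1-3)]
      have va: "vwalk a G" "vwalk b G" "vwalk u G" "vwalk v G" using vwalk_cf 1 2 by blast+
      from nest_refinement[OF 1(1) 2(1)] consider
          (1) r where "nest r v = Some b" "nest a r = Some u"
        | (2) r where "nest r b = Some v" "nest u r = Some a"
        | (3) r where "nest r b = Some u" "nest r v = Some a"
        by blast
      then show ?thesis
      proof cases
        case r: (1 r)
        obtain g where g: "canonical_factorization G r g"
          using canonical_factorization_exists vwalk_nest[OF r(1), of G] va by blast
        \<comment> \<open>Both multisets become those of \<open>e1\<close>, \<open>g\<close> and
          \<open>f2\<close> together.\<close>
        have "canonical_factorization G b (Nest g f2)" "canonical_factorization G u (Nest e1 g)"
          using g r 1(4) 2(5) canonical_factorization_Nest by blast+
        then have "nontrivial_factors e2 = nontrivial_factors (Nest g f2)"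
          "nontrivial_factors f1 = nontrivial_factors (Nest e1 g)"
          using less.hyps sh1 sh2 1(5) 2(4) by blast+
        then show ?thesis using 1(6) 2(6) by (simp add: ac_simps)
      next
        case r: (2 r)
        obtain g where g: "canonical_factorization G r g"
          using canonical_factorization_exists vwalk_nest[OF r(1), of G] va by blast
        have "canonical_factorization G v (Nest g e2)" "canonical_factorization G a (Nest f1 g)"
          using g r 1(5) 2(4) canonical_factorization_Nest by blast+
        then have "nontrivial_factors f2 = nontrivial_factors (Nest g e2)"
          "nontrivial_factors e1 = nontrivial_factors (Nest f1 g)"
          using less.hyps sh1 sh2 1(4) 2(5) by blast+
        then show ?thesis using 1(6) 2(6) by (simp add: ac_simps)
      next
        case r: (3 r)
        obtain g where g: "canonical_factorization G r g"
          using canonical_factorization_exists vwalk_nest[OF r(1), of G] va by blast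
        have "canonical_factorization G u (Nest g e2)" "canonical_factorization G a (Nest g f2)"
          using g r 1(5) 2(5) canonical_factorization_Nest by blast+
        then have "nontrivial_factors f1 = nontrivial_factors (Nest g e2)"
          "nontrivial_factors e1 = nontrivial_factors (Nest g f2)"
          using less.hyps sh1 sh2 1(4) 2(4) by blast+
        then show ?thesis using 1(6) 2(6) by (simp add: ac_simps)
      qed
    qed (use nontriv[OF 1(1-3)] in auto)
  qed
qed

text \<open>
  Normal forms for \<^const>\<open>rearr\<close>.  The string \<open>[]\<close> is not a walk, but \<^const>\<open>trivial_walk\<close>
  holds of it, so it can serve as a unit.
\<close>

definition comb :: "'v vwalk list \<Rightarrow> 'v vwalk nexpr" where
  "comb ws = foldr (\<lambda>w. Nest (Factor w)) ws (Factor [])"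

lemma comb_simps: "comb [] = Factor []" "comb (w # ws) = Nest (Factor w) (comb ws)"
  by (simp_all add: comb_def)

declare rearr.trans [trans]

lemma rearr_unit: "rearr (Nest (Factor []) e) e"
  by (rule rearr.trans[OF rearr.swap rearr.triv]) (simp add: trivial_walk_def)

lemma rearr_comb_append: "rearr (Nest (comb xs) (comb ys)) (comb (xs @ ys))"
proof (induction xs)
  case (Cons w xs)
  have "rearr (Nest (Nest (Factor w) (comb xs)) (comb ys)) (Nest (Factor w) (Nest (comb xs) (comb ys)))"
    by (rule rearr.assoc)
  also have "rearr \<dots> (Nest (Factor w) (comb (xs @ ys)))"
    by (rule rearr.cong[OF rearr.refl Cons.IH])
  finally show ?case by (simp add: comb_simps)
qed (simp add: comb_simps rearr_unit)

lemma rearr_comb_mset: "mset xs = mset ys \<Longrightarrow> rearr (comb xs) (comb ys)"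
proof (induction xs arbitrary: ys)
  case (Cons w xs)
  then have "w \<in> set ys" by (metis list.set_intros(1) set_mset_mset)
  then obtain l r where ys: "ys = l @ w # r" by (metis split_list)
  have "rearr (comb (w # xs)) (Nest (Factor w) (comb (l @ r)))"
    unfolding comb_simps by (rule rearr.cong[OF rearr.refl Cons.IH]) (use Cons.prems ys in simp)
  \<comment> \<open>Swapping \<open>l\<close> behind \<open>r\<close> lets \<open>w\<close> join
    \<open>r\<close> by associativity; a last swap restores the order of \<open>ys\<close>.\<close>
  also have "rearr \<dots> (Nest (Factor w) (Nest (comb r) (comb l)))"
    by (rule rearr.cong[OF rearr.refl])
      (rule rearr.trans[OF rearr.sym[OF rearr_comb_append] rearr.swap])
  also have "rearr \<dots> (Nest (comb (w # r)) (comb l))"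
    unfolding comb_simps by (rule rearr.sym[OF rearr.assoc])
  also have "rearr \<dots> (comb ys)"
    unfolding ys by (rule rearr.trans[OF rearr.swap rearr_comb_append])
  finally show ?case .
qed (simp add: rearr.refl)

lemma rearr_comb: "\<exists>ws. mset ws = nontrivial_factors e \<and> rearr e (comb ws)"
proof (induction e)
  case (Factor w)
  \<comment> \<open>The unit is inserted on the left, and then the trivial \<open>w\<close> is
    deleted on the right of it.\<close>
  have "rearr (Factor w) (comb [])" if "trivial_walk w"
    unfolding comb_simps
    by (rule rearr.trans[OF rearr.sym[OF rearr_unit] rearr.triv[OF that]])
  moreover have "rearr (Factor w) (comb [w])"
    unfolding comb_simps by (rule rearr.sym[OF rearr.triv]) (simp add: trivial_walk_def)
  ultimately show ?case
    by (cases "trivial_walk w") (auto intro: exI[of _ "[]"] exI[of _ "[w]"])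
next
  case (Nest e f)
  then obtain xs ys where "mset xs = nontrivial_factors e" "rearr e (comb xs)"
    "mset ys = nontrivial_factors f" "rearr f (comb ys)" by blast
  then show ?case
    using rearr.trans[OF rearr.cong rearr_comb_append] by (intro exI[of _ "xs @ ys"]) auto
qed

text \<open>Both sides pass through \<open>comb\<close>. Such intermediate expressions may have
  value \<open>None\<close>, which \<open>rearr\<close> permits.\<close>

lemma rearrI:
  assumes "nontrivial_factors e = nontrivial_factors e'"
  shows "rearr e e'"
proof -
  obtain xs ys where "mset xs = nontrivial_factors e" "rearr e (comb xs)"
    "mset ys = nontrivial_factors e'" "rearr e' (comb ys)"
    using rearr_comb by metis
  then show ?thesis using assms rearr_comb_mset rearr.trans rearr.sym by metis
qed

lemma canonical_factorization_equiv:
  assumes "canonical_factorization G w e" "canonical_factorization G w e'"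
  shows "equiv_fact G w e e'"
  using assms rearrI[OF nontrivial_factors_unique[OF assms]]
  by (simp add: equiv_fact_def canonical_factorization_def)


section \<open>The near-algebra structure\<close>

lemma lookup_kscale: "Poly_Mapping.lookup (kscale c x) w = c * Poly_Mapping.lookup x w"
  by (simp add: kscale_def Poly_Mapping.map.rep_eq when_def)

lemma vector_space_kscale: "vector_space (kscale :: 'k :: field \<Rightarrow> ('w \<Rightarrow>\<^sub>0 'k) \<Rightarrow> _)"
  by unfold_locales
    (auto intro!: poly_mapping_eqI simp: lookup_kscale lookup_add algebra_simps)

lemma keys_kscale_subset: "Poly_Mapping.keys (kscale c x) \<subseteq> Poly_Mapping.keys x"
  by (auto simp: in_keys_iff lookup_kscale)

lemma subspace_quiver_space:
  "module.subspace kscale (quiver_space G :: ('v vwalk \<Rightarrow>\<^sub>0 'k :: field) set)"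
proof -
  interpret vector_space "kscale :: 'k \<Rightarrow> ('v vwalk \<Rightarrow>\<^sub>0 'k) \<Rightarrow> _"
    by (rule vector_space_kscale)
  show ?thesis
    unfolding subspace_def quiver_space_def using keys_add keys_kscale_subset by fastforce
qed

lemma kbasis_expansion:
  "x = (\<Sum>w\<in>Poly_Mapping.keys x. kscale (Poly_Mapping.lookup x w) (kbasis w))"
  by (rule poly_mapping_eqI)
    (simp add: lookup_sum lookup_kscale kbasis_def lookup_single when_def if_distrib in_keys_iff
      cong: if_cong)

lemma kbasis_in_quiver_space: "kbasis w \<in> quiver_space G \<longleftrightarrow> vwalk w G"
  by (simp add: quiver_space_def kbasis_def)

lemma inj_kbasis: "inj (kbasis :: 'w \<Rightarrow> 'w \<Rightarrow>\<^sub>0 'k :: field)"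
proof (rule injI)
  fix a b :: 'w
  assume "(kbasis a :: 'w \<Rightarrow>\<^sub>0 'k) = kbasis b"
  then have "Poly_Mapping.keys (kbasis a :: 'w \<Rightarrow>\<^sub>0 'k) = Poly_Mapping.keys (kbasis b :: 'w \<Rightarrow>\<^sub>0 'k)"
    by simp
  then show "a = b" by (simp add: kbasis_def)
qed

lemma span_kbasis:
  "module.span kscale ((kbasis :: _ \<Rightarrow> 'v vwalk \<Rightarrow>\<^sub>0 'k :: field) ` {w. vwalk w G}) = quiver_space G"
proof -
  interpret vector_space "kscale :: 'k \<Rightarrow> ('v vwalk \<Rightarrow>\<^sub>0 'k) \<Rightarrow> _"
    by (rule vector_space_kscale)
  show ?thesis
  proof
    show "span (kbasis ` {w. vwalk w G}) \<subseteq> (quiver_space G :: ('v vwalk \<Rightarrow>\<^sub>0 'k) set)"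
      by (rule span_minimal) (auto simp: kbasis_in_quiver_space subspace_quiver_space)
    show "(quiver_space G :: ('v vwalk \<Rightarrow>\<^sub>0 'k) set) \<subseteq> span (kbasis ` {w. vwalk w G})"
    proof
      fix x :: "'v vwalk \<Rightarrow>\<^sub>0 'k"
      assume "x \<in> quiver_space G"
      then have "(\<Sum>w\<in>Poly_Mapping.keys x. kscale (Poly_Mapping.lookup x w) (kbasis w))
          \<in> span (kbasis ` {w. vwalk w G})"
        by (intro span_sum span_scale span_base) (auto simp: quiver_space_def)
      then show "x \<in> span (kbasis ` {w. vwalk w G})"
        using kbasis_expansion[of x] by simp
    qed
  qed
qed

lemma independent_kbasis:
  "\<not> module.dependent kscale ((kbasis :: _ \<Rightarrow> 'w \<Rightarrow>\<^sub>0 'k :: field) ` A)"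
proof -
  interpret vector_space "kscale :: 'k \<Rightarrow> ('w \<Rightarrow>\<^sub>0 'k) \<Rightarrow> _"
    by (rule vector_space_kscale)
  show ?thesis
    unfolding independent_explicit_module
  proof (intro allI impI)
    fix T and u :: "('w \<Rightarrow>\<^sub>0 'k) \<Rightarrow> 'k" and v
    assume T: "finite T" "T \<subseteq> kbasis ` A" "(\<Sum>v\<in>T. kscale (u v) v) = 0" "v \<in> T"
    then obtain w where w: "v = kbasis w" by blast
    \<comment> \<open>Evaluation at \<open>w\<close> is the coordinate functional dual to
      \<open>v\<close>; it isolates \<open>u v\<close> in the vanishing combination.\<close>
    have "Poly_Mapping.lookup v' w = (if v' = v then 1 else 0)" if "v' \<in> T" for v'
      using that T(2) w by (auto simp: kbasis_def lookup_single when_def)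
    then have "(\<Sum>v'\<in>T. u v' * Poly_Mapping.lookup v' w) = (\<Sum>v'\<in>T. if v' = v then u v' else 0)"
      by (intro sum.cong) auto
    moreover have "(\<Sum>v'\<in>T. u v' * Poly_Mapping.lookup v' w) = 0"
      using arg_cong[OF T(3), of "\<lambda>p. Poly_Mapping.lookup p w"] by (simp add: lookup_sum lookup_kscale)
    ultimately show "u v = 0" using T by simp
  qed
qed

section \<open>The product on linear combinations of walks\<close>

lemma keys_parallel_sum: "Poly_Mapping.keys (parallel_sum y) \<subseteq> Poly_Mapping.keys y"
  by (simp add: parallel_sum_def)

text \<open>The inner sum does not involve \<open>x\<close>, so the product is visibly linear in its
  left argument.\<close>

lemma lookup_knest:
  "Poly_Mapping.lookup (knest x y) c =
    (\<Sum>w\<in>Poly_Mapping.keys x. Poly_Mapping.lookup x w *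
      (\<Sum>u\<in>Poly_Mapping.keys (parallel_sum y).
        Poly_Mapping.lookup (parallel_sum y) u * Poly_Mapping.lookup (kzero_or_walk (nest w u)) c))"
  by (simp add: knest_def lookup_sum lookup_kscale sum_distrib_left mult.assoc)

lemma knest_add_left: "knest (x + y) z = knest x z + knest y z"
proof (rule poly_mapping_eqI)
  fix c
  show "Poly_Mapping.lookup (knest (x + y) z) c = Poly_Mapping.lookup (knest x z + knest y z) c"
    unfolding lookup_add[of "knest x z"] lookup_knest
    \<comment> \<open>Cancellation may shrink the support of \<open>x + y\<close>; this is harmless
      since the summand is additive in the coefficient and vanishes at 0.\<close>
    by (rule setsum_keys_plus_distrib[where f = "\<lambda>w a. a * (\<Sum>u\<in>Poly_Mapping.keys (parallel_sum z).
        Poly_Mapping.lookup (parallel_sum z) u * Poly_Mapping.lookup (kzero_or_walk (nest w u)) c)"])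
      (simp_all add: algebra_simps)
qed

lemma knest_kscale_left: "knest (kscale a x) y = kscale a (knest x y)"
proof (rule poly_mapping_eqI)
  fix c
  let ?f = "\<lambda>w. \<Sum>u\<in>Poly_Mapping.keys (parallel_sum y).
    Poly_Mapping.lookup (parallel_sum y) u * Poly_Mapping.lookup (kzero_or_walk (nest w u)) c"
  have "Poly_Mapping.lookup (knest (kscale a x) y) c =
      (\<Sum>w\<in>Poly_Mapping.keys x. Poly_Mapping.lookup (kscale a x) w * ?f w)"
    unfolding lookup_knest
    \<comment> \<open>The support shrinks when \<open>a = 0\<close>; the extra summands are then
      zero.\<close>
    by (rule sum.mono_neutral_left) (auto simp: in_keys_iff lookup_kscale)
  also have "\<dots> = Poly_Mapping.lookup (kscale a (knest x y)) c"
    by (simp add: lookup_knest lookup_kscale sum_distrib_left mult.assoc)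
  finally show "Poly_Mapping.lookup (knest (kscale a x) y) c = Poly_Mapping.lookup (kscale a (knest x y)) c" .
qed

lemma knest_in_quiver_space:
  assumes "x \<in> quiver_space G" "y \<in> quiver_space G"
  shows "knest x y \<in> (quiver_space G :: ('v vwalk \<Rightarrow>\<^sub>0 'k :: field) set)"
proof -
  interpret vector_space "kscale :: 'k \<Rightarrow> ('v vwalk \<Rightarrow>\<^sub>0 'k) \<Rightarrow> _"
    by (rule vector_space_kscale)
  note sub = subspace_quiver_space[of G, where 'k = 'k]
  have "kzero_or_walk (nest w u) \<in> (quiver_space G :: ('v vwalk \<Rightarrow>\<^sub>0 'k) set)"
    if "w \<in> Poly_Mapping.keys x" "u \<in> Poly_Mapping.keys (parallel_sum y)" for w u
  proof (cases "nest w u")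
    case None
    then show ?thesis using subspace_0[OF sub] by (simp add: kzero_or_walk_def)
  next
    case (Some c)
    then have "vwalk c G"
      using vwalk_nest[OF Some, of G] assms that keys_parallel_sum[of y] by (auto simp: quiver_space_def)
    then show ?thesis using Some by (simp add: kzero_or_walk_def kbasis_in_quiver_space)
  qed
  then show ?thesis
    unfolding knest_def by (intro subspace_sum[OF sub] subspace_scale[OF sub]) auto
qed

lemma near_algebra_quiver_space:
  "near_algebra kscale (quiver_space G :: ('v vwalk \<Rightarrow>\<^sub>0 'k :: field) set) knest"
  unfolding near_algebra_def
  using vector_space_kscale subspace_quiver_space knest_in_quiver_space knest_add_left
    knest_kscale_left by blast

lemma parallel_sum_kbasis: "parallel_sum (kbasis b) = kbasis b"
  by (simp add: parallel_sum_def kbasis_def)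

lemma knest_kbasis: "knest (kbasis a) (kbasis b) = kzero_or_walk (nest a b)"
  by (rule poly_mapping_eqI) (simp add: lookup_knest parallel_sum_kbasis, simp add: kbasis_def)

lemma kbasis_nonzero: "kbasis a \<noteq> (0 :: 'w \<Rightarrow>\<^sub>0 'k :: field)"
  by (metis kbasis_def keys_single keys_zero insert_not_empty zero_neq_one)

lemma knest_zero_right: "knest x 0 = 0"
  by (simp add: knest_def parallel_sum_def)

theorem theorem1:
  fixes G :: "('v, 'e) pre_digraph"
  assumes "fin_digraph G" and "nomulti_digraph G"
  shows
    "(\<forall>w. vwalk w G \<longrightarrow>
        (\<exists>e. canonical_factorization G w e) \<and>
        (\<forall>e e'. canonical_factorization G w e \<longrightarrow> canonical_factorization G w e' \<longrightarrow>
           equiv_fact G w e e')) \<and>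
     (\<forall>w. vwalk w G \<longrightarrow>
        (\<exists>e. factorization_into_irreducibles G w e) \<and>
        (\<exists>!S. \<forall>e. factorization_into_irreducibles G w e \<longrightarrow> {f \<in> factors e. \<not> trivial_walk f} = S)) \<and>
     (\<forall>w. prime_walk G w \<longleftrightarrow> simple_walk G w) \<and>
     (\<forall>w. irreducible_walk G w \<longleftrightarrow> simple_walk G w) \<and>
     (\<forall>w. vwalk w G \<longrightarrow>
        (\<exists>e. factorization_into_primes G w e) \<and>
        (\<forall>e e'. factorization_into_primes G w e \<longrightarrow> factorization_into_primes G w e' \<longrightarrow>
           equiv_fact G w e e')) \<and>
     (near_algebra kscale (quiver_space G :: ('v vwalk \<Rightarrow>\<^sub>0 'k :: alg_closed_field) set) knest \<and>
      inj_on (kbasis :: _ \<Rightarrow> 'v vwalk \<Rightarrow>\<^sub>0 'k) {w. vwalk w G} \<and>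
      \<not> module.dependent kscale ((kbasis :: _ \<Rightarrow> 'v vwalk \<Rightarrow>\<^sub>0 'k) ` {w. vwalk w G}) \<and>
      module.span kscale ((kbasis :: _ \<Rightarrow> 'v vwalk \<Rightarrow>\<^sub>0 'k) ` {w. vwalk w G}) = quiver_space G \<and>
      (\<forall>a b. vwalk a G \<longrightarrow> vwalk b G \<longrightarrow>
         knest (kbasis a) (kbasis b) = (kzero_or_walk (nest a b) :: 'v vwalk \<Rightarrow>\<^sub>0 'k))) \<and>
     ((\<exists>u v. (u, v) \<in> arcs_ends G \<and> u \<noteq> v) \<longrightarrow>
        (\<exists>a b. vwalk a G \<and> vwalk b G \<and>
           knest (kbasis a) (kbasis b) \<noteq> (knest (kbasis b) (kbasis a) :: 'v vwalk \<Rightarrow>\<^sub>0 'k)) \<and>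
        (\<exists>a b c. vwalk a G \<and> vwalk b G \<and> vwalk c G \<and>
           knest (knest (kbasis a) (kbasis b)) (kbasis c) \<noteq>
           (knest (kbasis a) (knest (kbasis b) (kbasis c)) :: 'v vwalk \<Rightarrow>\<^sub>0 'k)) \<and>
        (\<exists>x \<in> quiver_space G. \<exists>y \<in> quiver_space G. \<exists>z \<in> quiver_space G.
           knest x (y + z) \<noteq> (knest x y + knest x z :: 'v vwalk \<Rightarrow>\<^sub>0 'k))) \<and>
     ((\<exists>u \<in> verts G. \<exists>v \<in> verts G. u \<noteq> v) \<longrightarrow>
        (\<exists>a b. vwalk a G \<and> vwalk b G \<and>
           kbasis a \<noteq> (0 :: 'v vwalk \<Rightarrow>\<^sub>0 'k) \<and> kbasis b \<noteq> (0 :: 'v vwalk \<Rightarrow>\<^sub>0 'k) \<and>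
           knest (kbasis a) (kbasis b) = (0 :: 'v vwalk \<Rightarrow>\<^sub>0 'k)))"
proof -
  interpret fin_digraph G by (rule assms(1))
  have primes: "factorization_into_primes G = canonical_factorization G"
    by (simp add: fun_eq_iff factorization_into_primes_def canonical_factorization_def prime_walk_iff)
  have irreducibles: "factorization_into_irreducibles G = canonical_factorization G"
    by (simp add: fun_eq_iff factorization_into_irreducibles_def canonical_factorization_def
        irreducible_walk_iff)
  have unique_set: "\<exists>!S. \<forall>e. canonical_factorization G w e \<longrightarrow> {f \<in> factors e. \<not> trivial_walk f} = S"
    if w: "vwalk w G" for w
  proof -
    obtain e where e: "canonical_factorization G w e"
      using canonical_factorization_exists[OF w] by blast
    have eq: "{f \<in> factors e'. \<not> trivial_walk f} = {f \<in> factors e. \<not> trivial_walk f}"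
      if "canonical_factorization G w e'" for e'
      unfolding set_nontrivial_factors[symmetric] nontrivial_factors_unique[OF that e] ..
    show ?thesis
    proof (rule ex1I)
      show "\<forall>e'. canonical_factorization G w e' \<longrightarrow>
          {f \<in> factors e'. \<not> trivial_walk f} = {f \<in> factors e. \<not> trivial_walk f}"
        using eq by blast
    \<comment> \<open>Existence of \<open>e\<close> is what makes the set unique; without any
      factorization every set would qualify.\<close>
    qed (use e in blast)
  qed
  have "(\<exists>a b. vwalk a G \<and> vwalk b G \<and>
         knest (kbasis a) (kbasis b) \<noteq> (knest (kbasis b) (kbasis a) :: 'v vwalk \<Rightarrow>\<^sub>0 'k)) \<and>
      (\<exists>a b c. vwalk a G \<and> vwalk b G \<and> vwalk c G \<and>
         knest (knest (kbasis a) (kbasis b)) (kbasis c) \<noteq>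
         (knest (kbasis a) (knest (kbasis b) (kbasis c)) :: 'v vwalk \<Rightarrow>\<^sub>0 'k)) \<and>
      (\<exists>x \<in> quiver_space G. \<exists>y \<in> quiver_space G. \<exists>z \<in> quiver_space G.
         knest x (y + z) \<noteq> (knest x y + knest x z :: 'v vwalk \<Rightarrow>\<^sub>0 'k))" (is ?Q)
    if edge: "(u, v) \<in> arcs_ends G" "u \<noteq> v" for u v
  proof -
    have walks: "vwalk [u, v] G" "vwalk [u] G" "vwalk [v] G"
      using edge adj_in_verts by (auto simp: vwalk_def)
    have ne: "(0 :: 'v vwalk \<Rightarrow>\<^sub>0 'k) \<noteq> kbasis a" for a
      using kbasis_nonzero by metis
    let ?a = "kbasis [u, v] :: 'v vwalk \<Rightarrow>\<^sub>0 'k" and ?u = "kbasis [u] :: 'v vwalk \<Rightarrow>\<^sub>0 'k"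
      and ?v = "kbasis [v] :: 'v vwalk \<Rightarrow>\<^sub>0 'k"
    \<comment> \<open>An open walk can never be nested into another walk.\<close>
    have open_right: "nest x [u, v] = None" for x
      using edge by (simp add: nest_def canonical_def cycle_off_def)
    \<comment> \<open>With one edge \<open>a\<close> from \<open>u\<close> to \<open>v\<close>,
      \<open>a\<close> times \<open>u\<close> is \<open>a\<close> but \<open>u\<close> times
      \<open>a\<close> is 0, and bracketing \<open>a\<close>, \<open>u\<close>, \<open>v\<close> to
      the left gives \<open>a\<close>, to the right 0.\<close>
    have prods: "knest ?a ?u = ?a" "knest ?a ?v = ?a" "knest ?u ?v = 0" "knest ?u ?a = 0" "knest ?a ?a = 0"
      using edge by (simp_all add: knest_kbasis nest_trivial_right open_right kzero_or_walk_def)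
    \<comment> \<open>The walks \<open>[u]\<close> and \<open>[u, v]\<close> have different final
      vertices, so their sum counts as 0 when nested; separately they contribute \<open>a\<close>
      and 0.\<close>
    have "Poly_Mapping.keys (?u + ?a) = {[u], [u, v]}"
      by (auto simp: kbasis_def in_keys_iff lookup_add lookup_single when_def split: if_splits)
    then have "parallel_sum (?u + ?a) = 0"
      using edge by (auto simp: parallel_sum_def)
    then have "knest ?a (?u + ?a) = 0"
      by (simp add: knest_def)
    then have "knest ?a (?u + ?a) \<noteq> knest ?a ?u + knest ?a ?a"
      using prods ne by simp
    moreover have "knest ?a ?u \<noteq> knest ?u ?a"
      using prods kbasis_nonzero by simp
    moreover have "knest (knest ?a ?u) ?v \<noteq> knest ?a (knest ?u ?v)"
      using prods kbasis_nonzero by (simp add: knest_zero_right)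
    ultimately show ?thesis
      using walks kbasis_in_quiver_space by blast
  qed
  moreover have "\<exists>a b. vwalk a G \<and> vwalk b G \<and>
      kbasis a \<noteq> (0 :: 'v vwalk \<Rightarrow>\<^sub>0 'k) \<and> kbasis b \<noteq> (0 :: 'v vwalk \<Rightarrow>\<^sub>0 'k) \<and>
      knest (kbasis a) (kbasis b) = (0 :: 'v vwalk \<Rightarrow>\<^sub>0 'k)" (is ?Z)
    if "u \<in> verts G" "v \<in> verts G" "u \<noteq> v" for u v
    \<comment> \<open>Trivial walks at distinct vertices have product zero.\<close>
    using that
    by (intro exI[of _ "[u]"] exI[of _ "[v]"])
      (auto simp: vwalk_def kbasis_nonzero knest_kbasis nest_trivial_right kzero_or_walk_def)
  ultimately have noncommutative_zero_divisors:
    "(\<exists>u v. (u, v) \<in> arcs_ends G \<and> u \<noteq> v) \<longrightarrow> ?Q" "(\<exists>u \<in> verts G. \<exists>v \<in> verts G. u \<noteq> v) \<longrightarrow> ?Z"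
    by blast+
  have canonical: "\<forall>w. vwalk w G \<longrightarrow> (\<exists>e. canonical_factorization G w e) \<and>
      (\<forall>e e'. canonical_factorization G w e \<longrightarrow> canonical_factorization G w e' \<longrightarrow> equiv_fact G w e e')"
    using canonical_factorization_exists canonical_factorization_equiv by blast
  have factor_set: "\<forall>w. vwalk w G \<longrightarrow> (\<exists>e. canonical_factorization G w e) \<and>
      (\<exists>!S. \<forall>e. canonical_factorization G w e \<longrightarrow> {f \<in> factors e. \<not> trivial_walk f} = S)"
    by (intro allI impI conjI canonical_factorization_exists unique_set)
  have products: "\<forall>a b. vwalk a G \<longrightarrow> vwalk b G \<longrightarrow>
      knest (kbasis a) (kbasis b) = (kzero_or_walk (nest a b) :: 'v vwalk \<Rightarrow>\<^sub>0 'k)"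
    by (simp add: knest_kbasis)
  show ?thesis
    unfolding primes irreducibles
    by (intro conjI canonical factor_set allI[OF prime_walk_iff] allI[OF irreducible_walk_iff]
        near_algebra_quiver_space inj_on_subset[OF inj_kbasis subset_UNIV] independent_kbasis
        span_kbasis products noncommutative_zero_divisors)
qed

end
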